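(* Assuming the Strong Triangle Conjecture, for no $\epsilon>0$ is there a combinatorial algorithm with running time $O(n^{3-\epsilon})$ or $O((k\cdot n^2)^{1-\epsilon})$ for disjunctive safety (objectives or queries) with $k$ target sets in graphs with $n$ vertices. In particular, there is no such algorithm deciding whether the winning set is non-empty or deciding whether a specific vertex is in the winning set.
   Context: A graph here is a finite directed graph $G=(V,E)$ (an MDP without random vertices). A play is an infinite path. For $T\subseteq V$, $\mathrm{Safety}(T)$ is the set of plays never visiting a vertex of $T$. The winning set of an objective $\psi$ is the set of vertices from which some infinite path in $\psi$ starts. The disjunctive objective of $\mathrm{Safety}(T_1),\dots,\mathrm{Safety}(T_k)$ is their union; the disjunctive query's winning set is the union of the individual winning sets (on graphs these coincide). Strong Triangle Conjecture (STC): there is no $O(\min\{n^{\omega-\epsilon},m^{2\omega/(\omega+1)-\epsilon}\})$ expected time algorithm and no $O(n^{3-\epsilon})$ time combinatorial algorithm (one avoiding fast matrix multiplication) that detects whether a graph contains a triangle, for any $\epsilon>0$, where $\omega<2.373$ is the matrix multiplication exponent.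
   Formalization: "Combinatorial algorithm" has no precise definition; it is taken to be any class of algorithms, the same in the conjecture and in the conclusion, that is assumed closed under first running a linear-time preprocessing of the input. *)

theory Defs
  imports "HOL-Probability.Probability"
begin

section \<open>Word RAM programs\<close>

text \<open>
  Running times refer to a unit-cost RAM with finitely many registers used by each program, an
  indirectly addressed memory, and fair coin flips (needed only for expected-time algorithms).
  Words have \<open>O(log N)\<close> bits: the execution relation carries a bound \<open>B\<close> on all values
  that are produced, and an execution that would exceed it is stuck, i.e. has no result.
  Without such a bound, unit-cost arithmetic on huge numbers would be unrealistically powerful.
\<close>

datatype binop = Add | Sub | Mul | Div | Mod | And | Or | Xor | ShiftL | ShiftR | Less | Equal

fun binop_val :: "binop \<Rightarrow> nat \<Rightarrow> nat \<Rightarrow> nat" where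
  "binop_val Add a b = a + b"
| "binop_val Sub a b = a - b"
| "binop_val Mul a b = a * b"
| "binop_val Div a b = a div b"
| "binop_val Mod a b = a mod b"
| "binop_val And a b = Bit_Operations.and a b"
| "binop_val Or a b = Bit_Operations.or a b"
| "binop_val Xor a b = Bit_Operations.xor a b"
| "binop_val ShiftL a b = push_bit b a"
| "binop_val ShiftR a b = drop_bit b a"
| "binop_val Less a b = of_bool (a < b)"
| "binop_val Equal a b = of_bool (a = b)"

datatype prog =
    Skip
  | Const nat nat
  | Binop binop nat nat nat
  | Load nat nat
  | Store nat nat
  | Flip nat
  | Seq prog prog
  | Cond nat prog prog
  | While nat prog

record state =
  reg :: "nat \<Rightarrow> nat"
  mem :: "nat \<Rightarrow> nat"
  coins :: "bool stream"

text \<open>\<open>exec B p s t s'\<close>: started in \<open>s\<close>, program \<open>p\<close> halts in \<open>s'\<close> after \<open>t\<close> steps,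
  never producing a value greater than \<open>B\<close>.\<close>

inductive exec :: "nat \<Rightarrow> prog \<Rightarrow> state \<Rightarrow> nat \<Rightarrow> state \<Rightarrow> bool" for B :: nat where
  Skip: "exec B Skip s 1 s"
| Const: "c \<le> B \<Longrightarrow> exec B (Const r c) s 1 (s\<lparr>reg := (reg s)(r := c)\<rparr>)"
| Binop: "v = binop_val f (reg s a) (reg s b) \<Longrightarrow> v \<le> B \<Longrightarrow>
    exec B (Binop f r a b) s 1 (s\<lparr>reg := (reg s)(r := v)\<rparr>)"
| Load: "exec B (Load r a) s 1 (s\<lparr>reg := (reg s)(r := mem s (reg s a))\<rparr>)"
| Store: "exec B (Store a b) s 1 (s\<lparr>mem := (mem s)(reg s a := reg s b)\<rparr>)"
| Flip: "exec B (Flip r) s 1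
    (s\<lparr>reg := (reg s)(r := of_bool (shd (coins s))), coins := stl (coins s)\<rparr>)"
| Seq: "exec B p s t s' \<Longrightarrow> exec B q s' u s'' \<Longrightarrow> exec B (Seq p q) s (t + u) s''"
| Cond_True: "reg s r \<noteq> 0 \<Longrightarrow> exec B p s t s' \<Longrightarrow> exec B (Cond r p q) s (t + 1) s'"
| Cond_False: "reg s r = 0 \<Longrightarrow> exec B q s t s' \<Longrightarrow> exec B (Cond r p q) s (t + 1) s'"
| While_False: "reg s r = 0 \<Longrightarrow> exec B (While r p) s 1 s"
| While_True: "reg s r \<noteq> 0 \<Longrightarrow> exec B p s t s' \<Longrightarrow> exec B (While r p) s' u s'' \<Longrightarrow>
    exec B (While r p) s (t + u + 1) s''"

definition init :: "nat list \<Rightarrow> bool stream \<Rightarrow> state" where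
  "init xs w = \<lparr>reg = (\<lambda>_. 0),
     mem = (\<lambda>i. if i \<le> length xs then (length xs # xs) ! i else 0),
     coins = w\<rparr>"

text \<open>Polynomial in the length and the largest entry of the input, so that a word has
  logarithmically many bits. The constant \<open>c\<close> may depend on the program.\<close>

definition word_bound :: "nat \<Rightarrow> nat list \<Rightarrow> nat" where
  "word_bound c xs = (Max (insert (length xs) (set xs)) + 2) ^ c"

text \<open>Program \<open>p\<close> solves, in worst-case time \<open>O(f)\<close>, the problem whose instances are the elements
  of \<open>I\<close>; \<open>enc x\<close> is the input for instance \<open>x\<close>, and \<open>ok x\<close> tells which final memory contents are
  correct for \<open>x\<close>. Quantifying over all coin sequences makes this a statement about deterministic
  algorithms.\<close>

definition solves_in_time ::
  "'i set \<Rightarrow> ('i \<Rightarrow> nat list) \<Rightarrow> ('i \<Rightarrow> (nat \<Rightarrow> nat) \<Rightarrow> bool) \<Rightarrow> ('i \<Rightarrow> real) \<Rightarrow> prog \<Rightarrow> bool" where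
  "solves_in_time I enc ok f p \<longleftrightarrow>
     (\<exists>(K::real) c. \<forall>x\<in>I. \<forall>w. \<exists>t s.
        exec (word_bound c (enc x)) p (init (enc x) w) t s \<and> ok x (mem s) \<and> real t \<le> K * f x)"

definition run_time :: "nat \<Rightarrow> prog \<Rightarrow> state \<Rightarrow> ennreal" where
  "run_time B p s = (INF t\<in>{t. \<exists>s'. exec B p s t s'}. ennreal (real t))"

text \<open>The infimum ranges over at most one value; it is infinite for an execution that diverges
  or is stuck.\<close>

definition coin_space :: "bool stream measure" where
  "coin_space = stream_space (measure_pmf (bernoulli_pmf (1 / 2)))"

definition solves_in_expected_time ::
  "'i set \<Rightarrow> ('i \<Rightarrow> nat list) \<Rightarrow> ('i \<Rightarrow> (nat \<Rightarrow> nat) \<Rightarrow> bool) \<Rightarrow> ('i \<Rightarrow> real) \<Rightarrow> prog \<Rightarrow> bool" where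
  "solves_in_expected_time I enc ok f p \<longleftrightarrow>
     (\<exists>(K::real) c. \<forall>x\<in>I.
        (\<forall>w t s. exec (word_bound c (enc x)) p (init (enc x) w) t s \<longrightarrow> ok x (mem s)) \<and>
        (\<integral>\<^sup>+ w. run_time (word_bound c (enc x)) p (init (enc x) w) \<partial>coin_space) \<le> ennreal (K * f x))"

section \<open>Combinatorial algorithms\<close>

text \<open>
  ``Combinatorial'' (``avoiding fast matrix multiplication'') has no formal definition. It is
  therefore an arbitrary predicate on programs, of which only the following is required: running
  a linear-time preprocessing first does not make an algorithm non-combinatorial.

  The preprocessing has to be linear on every input and has to leave behind a clean input of
  linear length. This makes linear preprocessings closed under composition. Under a laxer
  condition, a superlinear algorithm (such as fast matrix multiplication) could be composed of
  preprocessings, each of which is superlinear only on states that its predecessors produce.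
\<close>

definition linear_preprocessing :: "prog \<Rightarrow> bool" where
  "linear_preprocessing q \<longleftrightarrow>
     (\<exists>c. \<forall>xs w. \<exists>t ys. exec (word_bound c xs) q (init xs w) t (init ys w) \<and>
        t \<le> c * (length xs + 1) \<and> length ys \<le> c * (length xs + 1))"

definition closed_under_linear_preprocessing :: "(prog \<Rightarrow> bool) \<Rightarrow> bool" where
  "closed_under_linear_preprocessing C \<longleftrightarrow>
     (\<forall>q p. linear_preprocessing q \<longrightarrow> C p \<longrightarrow> C (Seq q p))"

section \<open>The matrix multiplication exponent\<close>

text \<open>Straight-line arithmetic programs over the rationals; operands are indices into the list of
  the values available so far, which starts with the inputs.\<close>

datatype arith = AConst rat | AAdd nat nat | ASub nat nat | AMul nat nat

fun arith_val :: "rat list \<Rightarrow> arith \<Rightarrow> rat" where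
  "arith_val vs (AConst c) = c"
| "arith_val vs (AAdd i j) = vs ! i + vs ! j"
| "arith_val vs (ASub i j) = vs ! i - vs ! j"
| "arith_val vs (AMul i j) = vs ! i * vs ! j"

fun arith_wf :: "nat \<Rightarrow> arith \<Rightarrow> bool" where
  "arith_wf l (AConst c) = True"
| "arith_wf l (AAdd i j) = (i < l \<and> j < l)"
| "arith_wf l (ASub i j) = (i < l \<and> j < l)"
| "arith_wf l (AMul i j) = (i < l \<and> j < l)"

definition slp_vals :: "arith list \<Rightarrow> rat list \<Rightarrow> rat list" where
  "slp_vals P inp = foldl (\<lambda>vs a. vs @ [arith_val vs a]) inp P"

definition matrix_entries :: "nat \<Rightarrow> nat \<Rightarrow> (nat \<Rightarrow> nat \<Rightarrow> 'a) \<Rightarrow> 'a list" where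
  "matrix_entries r c M = concat (map (\<lambda>i. map (M i) [0..<c]) [0..<r])"

definition multiplies_matrices :: "nat \<Rightarrow> arith list \<Rightarrow> bool" where
  "multiplies_matrices n P \<longleftrightarrow>
     (\<forall>l < length P. arith_wf (2 * n\<^sup>2 + l) (P ! l)) \<and>
     (\<exists>out. \<forall>i<n. \<forall>j<n. out i j < 2 * n\<^sup>2 + length P \<and>
        (\<forall>A B. slp_vals P (matrix_entries n n A @ matrix_entries n n B) ! out i j =
                (\<Sum>k<n. A i k * B k j)))"

definition mm_exponent :: real where
  "mm_exponent = Inf {\<tau>. \<exists>K::real. \<forall>n\<ge>1. \<exists>P. multiplies_matrices n P \<and>
                              real (length P) \<le> K * real n powr \<tau>}"

section \<open>Triangle detection and the Strong Triangle Conjecture\<close>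

definition simple_graph :: "nat \<Rightarrow> nat set set \<Rightarrow> bool" where
  "simple_graph n E \<longleftrightarrow> (\<forall>e\<in>E. e \<subseteq> {..<n} \<and> card e = 2)"

definition has_triangle :: "nat set set \<Rightarrow> bool" where
  "has_triangle E \<longleftrightarrow> (\<exists>a b c. {a, b} \<in> E \<and> {b, c} \<in> E \<and> {a, c} \<in> E)"

text \<open>Decision problems: the answer is ``yes'' iff memory cell 0 is finally non-zero.\<close>

definition decides :: "('i \<Rightarrow> bool) \<Rightarrow> 'i \<Rightarrow> (nat \<Rightarrow> nat) \<Rightarrow> bool" where
  "decides Q x M \<longleftrightarrow> (M 0 \<noteq> 0 \<longleftrightarrow> Q x)"

text \<open>Dense inputs: \<open>n\<close> and the adjacency matrix.\<close>

definition matrix_graphs :: "(nat \<times> nat set set) set" where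
  "matrix_graphs = {(n, E). n \<ge> 1 \<and> simple_graph n E}"

fun enc_matrix_graph :: "nat \<times> nat set set \<Rightarrow> nat list" where
  "enc_matrix_graph (n, E) = n # matrix_entries n n (\<lambda>i j. of_bool ({i, j} \<in> E))"

text \<open>Sparse inputs: \<open>n\<close>, \<open>m\<close> and a list of the \<open>m\<close> edges in arbitrary order; with an adjacency
  matrix, a running time depending on \<open>m\<close> only would be out of reach for a trivial reason.\<close>

fun edge_set :: "(nat \<times> nat) list \<Rightarrow> nat set set" where
  "edge_set es = (\<lambda>(u, v). {u, v}) ` set es"

definition list_graphs :: "(nat \<times> (nat \<times> nat) list) set" where
  "list_graphs = {(n, es). n \<ge> 1 \<and> es \<noteq> [] \<and> simple_graph n (edge_set es) \<and>
                           distinct (map (\<lambda>(u, v). {u, v}) es)}"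

fun enc_list_graph :: "nat \<times> (nat \<times> nat) list \<Rightarrow> nat list" where
  "enc_list_graph (n, es) = n # length es # concat (map (\<lambda>(u, v). [u, v]) es)"

definition strong_triangle_conjecture :: "(prog \<Rightarrow> bool) \<Rightarrow> bool" where
  "strong_triangle_conjecture combinatorial \<longleftrightarrow>
     (\<forall>\<epsilon>>0. \<not> (\<exists>p. solves_in_expected_time list_graphs enc_list_graph
         (decides (\<lambda>(n, es). has_triangle (edge_set es)))
         (\<lambda>(n, es). min (real n powr (mm_exponent - \<epsilon>))
            (real (length es) powr (2 * mm_exponent / (mm_exponent + 1) - \<epsilon>))) p)) \<and>
     (\<forall>\<epsilon>>0. \<not> (\<exists>p. combinatorial p \<and> solves_in_time matrix_graphs enc_matrix_graph
         (decides (\<lambda>(n, E). has_triangle E)) (\<lambda>(n, E). real n powr (3 - \<epsilon>)) p))"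

section \<open>Disjunctive safety\<close>

definition plays :: "'v set \<Rightarrow> ('v \<times> 'v) set \<Rightarrow> (nat \<Rightarrow> 'v) set" where
  "plays V E = {\<pi>. range \<pi> \<subseteq> V \<and> (\<forall>i. (\<pi> i, \<pi> (Suc i)) \<in> E)}"

definition safety :: "'v set \<Rightarrow> ('v \<times> 'v) set \<Rightarrow> 'v set \<Rightarrow> (nat \<Rightarrow> 'v) set" where
  "safety V E T = {\<pi> \<in> plays V E. \<forall>i. \<pi> i \<notin> T}"

definition winning_set :: "'v set \<Rightarrow> ('v \<times> 'v) set \<Rightarrow> (nat \<Rightarrow> 'v) set \<Rightarrow> 'v set" where
  "winning_set V E \<psi> = {v \<in> V. \<exists>\<pi> \<in> plays V E. \<pi> \<in> \<psi> \<and> \<pi> 0 = v}"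

definition disj_objective_winning :: "'v set \<Rightarrow> ('v \<times> 'v) set \<Rightarrow> 'v set list \<Rightarrow> 'v set" where
  "disj_objective_winning V E Ts = winning_set V E (\<Union>T\<in>set Ts. safety V E T)"

definition disj_query_winning :: "'v set \<Rightarrow> ('v \<times> 'v) set \<Rightarrow> 'v set list \<Rightarrow> 'v set" where
  "disj_query_winning V E Ts = (\<Union>T\<in>set Ts. winning_set V E (safety V E T))"

type_synonym safety_inst = "nat \<times> (nat \<times> nat) set \<times> nat set list"

text \<open>Instances with \<open>n\<close> vertices and \<open>k\<close> target sets, where \<open>D n k\<close>. Taking \<open>\<lambda>n k. True\<close> for \<open>D\<close>
  imposes no restriction, but then time bounds such as \<open>O(n\<^sup>3\<^sup>-\<^sup>\<epsilon>)\<close> or \<open>O((k \<cdot> n\<^sup>2)\<^sup>1\<^sup>-\<^sup>\<epsilon>)\<close> are too short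
  even for reading the input when \<open>k\<close> is far larger (for the latter also: far smaller) than \<open>n\<close>.
  The lower bounds are therefore stated for every \<open>D\<close> that admits \<open>k = n\<close>.\<close>

definition safety_instances :: "(nat \<Rightarrow> nat \<Rightarrow> bool) \<Rightarrow> safety_inst set" where
  "safety_instances D = {(n, E, Ts). n \<ge> 1 \<and> length Ts \<ge> 1 \<and> D n (length Ts) \<and>
     E \<subseteq> {..<n} \<times> {..<n} \<and> (\<forall>T\<in>set Ts. T \<subseteq> {..<n})}"

fun enc_safety :: "safety_inst \<Rightarrow> nat list" where
  "enc_safety (n, E, Ts) = n # length Ts # matrix_entries n n (\<lambda>i j. of_bool ((i, j) \<in> E)) @
     matrix_entries (length Ts) n (\<lambda>i v. of_bool (v \<in> Ts ! i))"

definition vertex_instances :: "(nat \<Rightarrow> nat \<Rightarrow> bool) \<Rightarrow> (safety_inst \<times> nat) set" where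
  "vertex_instances D = {(x, v). x \<in> safety_instances D \<and> v < fst x}"

fun enc_vertex :: "safety_inst \<times> nat \<Rightarrow> nat list" where
  "enc_vertex (x, v) = enc_safety x @ [v]"

type_synonym winning = "nat set \<Rightarrow> (nat \<times> nat) set \<Rightarrow> nat set list \<Rightarrow> nat set"

text \<open>\<open>W\<close> is one of the two notions of winning set above, and \<open>f n k\<close> the time bound. The computed
  winning set is represented by its characteristic vector in the first \<open>n\<close> memory cells.\<close>

definition computes_winning_set ::
  "(nat \<Rightarrow> nat \<Rightarrow> bool) \<Rightarrow> winning \<Rightarrow> (nat \<Rightarrow> nat \<Rightarrow> real) \<Rightarrow> prog \<Rightarrow> bool" where
  "computes_winning_set D W f = solves_in_time (safety_instances D) enc_safety
     (\<lambda>(n, E, Ts) M. \<forall>v<n. M v \<noteq> 0 \<longleftrightarrow> v \<in> W {..<n} E Ts)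
     (\<lambda>(n, E, Ts). f n (length Ts))"

definition decides_winning_nonempty ::
  "(nat \<Rightarrow> nat \<Rightarrow> bool) \<Rightarrow> winning \<Rightarrow> (nat \<Rightarrow> nat \<Rightarrow> real) \<Rightarrow> prog \<Rightarrow> bool" where
  "decides_winning_nonempty D W f = solves_in_time (safety_instances D) enc_safety
     (decides (\<lambda>(n, E, Ts). W {..<n} E Ts \<noteq> {}))
     (\<lambda>(n, E, Ts). f n (length Ts))"

definition decides_winning_vertex ::
  "(nat \<Rightarrow> nat \<Rightarrow> bool) \<Rightarrow> winning \<Rightarrow> (nat \<Rightarrow> nat \<Rightarrow> real) \<Rightarrow> prog \<Rightarrow> bool" where
  "decides_winning_vertex D W f = solves_in_time (vertex_instances D) enc_vertex
     (decides (\<lambda>((n, E, Ts), v). v \<in> W {..<n} E Ts))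
     (\<lambda>((n, E, Ts), v). f n (length Ts))"

end

theory Submission
  imports Defs
begin

text \<open>
  A graph \<open>(n, E)\<close> is turned into a game graph on the \<open>4n\<close> vertices \<open>4i + b\<close> with \<open>i < n\<close>, \<open>b < 4\<close>,
  where \<open>b\<close> is a layer. Layer 0 consists of sources with edges to all of layer 1; the other layers
  are traversed cyclically, 1 to 2 to 3 to 1, along edges of \<open>E\<close>. The target set of index \<open>4i + b\<close>
  is layer 1 without the copy of \<open>i\<close>. Every play passes through layer 1 again and again, and if it
  avoids such a target set it always meets the same copy there, so three consecutive steps form a
  triangle through \<open>i\<close>; conversely a triangle yields a safe play from vertex 0. Hence ``vertex 0
  wins'', ``some vertex wins'' and ``there is a triangle'' are equivalent. The number of target sets
  is \<open>4n\<close> as well, so both time bounds become \<open>O(n\<^sup>3\<^sup>-\<^sup>\<epsilon>)\<close>, and the instance can be written down in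
  time linear in the size \<open>n\<^sup>2\<close> of the adjacency matrix.
\<close>

section \<open>Straight-line code\<close>

text \<open>Executing straight-line code becomes rewriting with this function. Its last clause is a
  dummy: \<open>fits\<close> rejects those commands.\<close>

fun eff :: "prog \<Rightarrow> state \<Rightarrow> state" where
  "eff (Const r c) s = s\<lparr>reg := (reg s)(r := c)\<rparr>"
| "eff (Binop f r a b) s = s\<lparr>reg := (reg s)(r := binop_val f (reg s a) (reg s b))\<rparr>"
| "eff (Load r a) s = s\<lparr>reg := (reg s)(r := mem s (reg s a))\<rparr>"
| "eff (Store a b) s = s\<lparr>mem := (mem s)(reg s a := reg s b)\<rparr>"
| "eff _ s = s"

fun fits :: "nat \<Rightarrow> prog \<Rightarrow> state \<Rightarrow> bool" where
  "fits B (Const r c) s \<longleftrightarrow> c \<le> B"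
| "fits B (Binop f r a b) s \<longleftrightarrow> binop_val f (reg s a) (reg s b) \<le> B"
| "fits B (Load r a) s \<longleftrightarrow> True"
| "fits B (Store a b) s \<longleftrightarrow> True"
| "fits B _ s \<longleftrightarrow> False"

fun fits_all :: "nat \<Rightarrow> prog list \<Rightarrow> state \<Rightarrow> bool" where
  "fits_all B [] s \<longleftrightarrow> True"
| "fits_all B (p # ps) s \<longleftrightarrow> fits B p s \<and> fits_all B ps (eff p s)"

fun seqs :: "prog list \<Rightarrow> prog" where
  "seqs [] = Skip"
| "seqs (p # ps) = Seq p (seqs ps)"

lemma exec_eff:
  assumes "fits B p s"
  shows "exec B p s 1 (eff p s)"
  using assms
  by (cases "(B, p, s)" rule: fits.cases)
     (auto intro: exec.Const exec.Binop exec.Load exec.Store simp del: One_nat_def)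

lemma exec_seqs: "fits_all B ps s \<Longrightarrow> exec B (seqs ps) s (length ps + 1) (fold eff ps s)"
proof (induction ps arbitrary: s)
  case Nil
  then show ?case using exec.Skip by simp
next
  case (Cons p ps)
  then show ?case using exec.Seq[OF exec_eff, of B p s "seqs ps" "length ps + 1"] by simp
qed

text \<open>Lets the reduction and a solver, each with its own word bound, run under a common larger
  one.\<close>

lemma exec_mono: "exec B p s t s' \<Longrightarrow> B \<le> B' \<Longrightarrow> exec B' p s t s'"
  by (induction rule: exec.induct) (blast intro: exec.intros dest: le_trans)+

section \<open>The reduction program\<close>

text \<open>Entry \<open>x\<close> of the two stacked \<open>4n \<times> 4n\<close> matrices of the game graph (edges, then targets), where
  \<open>M\<close> is the memory holding the adjacency matrix of the source graph from address 2 on. Row \<open>r \<ge> 4n\<close>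
  is the target set of index \<open>r - 4n\<close>, and \<open>(r - 4n) div 4 = r div 4 mod n\<close>.\<close>

definition cell :: "(nat \<Rightarrow> nat) \<Rightarrow> nat \<Rightarrow> nat \<Rightarrow> nat" where
  "cell M n x = (let r = x div (4 * n); c = x mod (4 * n); i = r div 4 mod n; j = c div 4 in
     of_bool (if r < 4 * n
       then c mod 4 = r mod 4 mod 3 + 1 \<and> (r mod 4 = 0 \<or> M (i * n + j + 2) \<noteq> 0)
       else c mod 4 = 1 \<and> j \<noteq> i))"

text \<open>Registers: 0 holds 0, 2 holds 1, 3 holds \<open>n\<close>, 5 holds 4, 6 holds 3, 7 holds \<open>4n\<close>, 8 is the loop
  counter, and 9 holds the length of the result. The cells are written in place, from the last one
  down: the matrix entry needed for cell \<open>x\<close>, which goes to address \<open>x + 3\<close>, has address at most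
  \<open>x + 2\<close> and is therefore still intact.\<close>

definition loop_body :: "prog list" where
  "loop_body =
    [Binop Sub 8 8 2, Binop Div 10 8 7, Binop Mod 11 8 7, Binop Div 12 10 5, Binop Mod 13 12 3,
     Binop Mod 14 10 5, Binop Div 15 11 5, Binop Mod 16 11 5,
     Binop Mul 17 13 3, Binop Add 17 17 15, Binop Add 17 17 2, Binop Add 17 17 2, Load 17 17,
     Binop Equal 18 14 0, Binop Add 17 17 18, Binop Less 17 0 17,
     Binop Mod 14 14 6, Binop Add 14 14 2, Binop Equal 14 14 16, Binop Mul 17 17 14,
     Binop Less 18 10 7, Binop Mul 17 17 18,
     Binop Equal 13 13 15, Binop Equal 13 13 0, Binop Equal 16 16 2, Binop Mul 13 13 16,
     Binop Equal 18 18 0, Binop Mul 13 13 18, Binop Add 17 17 13,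
     Binop Add 18 8 6, Store 18 17]"

text \<open>\<open>y\<close> counts the cells still to be written. Registers 1, 4 and 10 to 18 are
  left free; those from 19 on stay 0, as the clean final state requires.\<close>

definition loop_inv :: "(nat \<Rightarrow> nat) \<Rightarrow> nat \<Rightarrow> bool stream \<Rightarrow> nat \<Rightarrow> nat \<Rightarrow> state \<Rightarrow> bool" where
  "loop_inv M n w l y s \<longleftrightarrow> coins s = w \<and>
     reg s 0 = 0 \<and> reg s 2 = 1 \<and> reg s 3 = n \<and> reg s 5 = 4 \<and> reg s 6 = 3 \<and> reg s 7 = 4 * n \<and>
     reg s 8 = y \<and> reg s 9 = l \<and> (\<forall>k\<ge>19. reg s k = 0) \<and>
     mem s = (\<lambda>a. if y + 3 \<le> a \<and> a < 32 * n\<^sup>2 + 3 then cell M n (a - 3) else M a)"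

text \<open>Division and remainder can only shrink the row number and the column, and
  \<open>n \<le> 4 * n\<close>, so the quotient-remainder decomposition of \<open>x\<close>
  dominates. This makes writing in place safe.\<close>

lemma source_index_le:
  fixes x n :: nat
  shows "(x div (4 * n) div 4 mod n) * n + x mod (4 * n) div 4 \<le> x"
proof -
  have "x div (4 * n) div 4 mod n \<le> x div (4 * n)"
    by (meson div_le_dividend le_trans mod_less_eq_dividend)
  then have "(x div (4 * n) div 4 mod n) * n \<le> x div (4 * n) * (4 * n)"
    by (intro mult_le_mono) auto
  moreover have "x mod (4 * n) div 4 \<le> x mod (4 * n)" by simp
  ultimately have "(x div (4 * n) div 4 mod n) * n + x mod (4 * n) div 4
      \<le> x div (4 * n) * (4 * n) + x mod (4 * n)"
    by linarith
  then show ?thesis by (simp only: div_mult_mod_eq)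
qed

lemma loop_body_correct:
  assumes inv: "loop_inv M n w l (Suc x) s" and x: "x < 32 * n\<^sup>2"
    and B: "32 * n\<^sup>2 + 6 \<le> B" and M: "\<And>a. M a + 1 \<le> B"
  shows "fits_all B loop_body s \<and> loop_inv M n w l x (fold eff loop_body s)"
proof -
  obtain r where r: "x div (4 * n) = r" by simp
  obtain c where c: "x mod (4 * n) = c" by simp
  obtain q where q: "r div 4 = q" by simp
  obtain i where i: "q mod n = i" by simp
  obtain b where b: "r mod 4 = b" by simp
  obtain j where j: "c div 4 = j" by simp
  obtain d where d: "c mod 4 = d" by simp
  obtain e where e: "b mod 3 = e" by simp
  have addr: "i * n + j \<le> x"
    using source_index_le[of x n] by (simp add: r c q i j)
  have le: "r \<le> x" "c \<le> x" "q \<le> x" "i \<le> x" "j \<le> x" "b < 4" "d < 4" "e < 3"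
    using r c q i j b d e div_le_dividend mod_less_eq_dividend
    by (auto intro: le_trans) (meson div_le_dividend mod_less_eq_dividend le_trans)+
  have prod: "i * n \<le> x" using addr by linarith
  note regs = inv[unfolded loop_inv_def]
  define m where "m = M (i * n + j + 2)"
  have m: "mem s (i * n + j + 2) = m" "mem s (Suc (Suc (i * n + j))) = m"
    using regs addr by (auto simp: m_def)
  \<comment> \<open>The program adds the loaded entry and the test for layer 0; the sum is positive
    iff one of them is. Hence the spare 1 in the bound on \<open>M\<close>.\<close>
  obtain m' where m': "m + of_bool (b = 0) = m'" by simp
  have m1: "m' \<le> B" using M[of "i * n + j + 2"] m' by (auto simp: m_def)
  \<comment> \<open>Case distinctions are computed as products of truth values; at most one of the
    two summands is 1.\<close>
  have cell: "cell M n x = of_bool (0 < m') * of_bool (e + 1 = d)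
      * of_bool (r < 4 * n) + of_bool (j \<noteq> i) * of_bool (d = 1) * of_bool (\<not> r < 4 * n)"
    by (auto simp: cell_def Let_def r c q i b j d e m_def simp flip: m')
  have bool_le: "of_bool P \<le> B" and bool_add_le: "of_bool P + of_bool Q \<le> B" for P Q
    using B by auto
  have "fits_all B loop_body s"
    using regs le prod addr x B m m1
    by (simp add: loop_body_def r c q i b j d e m' bool_le bool_add_le flip: of_bool_conj
        split del: split_of_bool)
  moreover have "loop_inv M n w l x (fold eff loop_body s)"
    using regs le prod addr x B m m1 cell
    by (simp add: loop_body_def loop_inv_def r c q i b j d e m' flip: of_bool_conj
        split del: split_of_bool) (auto simp: fun_eq_iff)
  ultimately show ?thesis by blast
qed

lemma loop_correct:
  assumes B: "32 * n\<^sup>2 + 6 \<le> B" and M: "\<And>a. M a + 1 \<le> B"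
  shows "loop_inv M n w l y s \<Longrightarrow> y \<le> 32 * n\<^sup>2 \<Longrightarrow>
    \<exists>s'. exec B (While 8 (seqs loop_body)) s (33 * y + 1) s' \<and> loop_inv M n w l 0 s'"
proof (induction y arbitrary: s)
  case 0
  then show ?case using exec.While_False[of s 8 B] by (auto simp: loop_inv_def)
next
  case (Suc x)
  from Suc.prems have body: "fits_all B loop_body s" "loop_inv M n w l x (fold eff loop_body s)"
    using loop_body_correct[OF Suc.prems(1) _ B M] by auto
  from Suc.IH[OF body(2)] Suc.prems(2) obtain s' where
    s': "exec B (While 8 (seqs loop_body)) (fold eff loop_body s) (33 * x + 1) s'"
      "loop_inv M n w l 0 s'"
    by auto
  have "reg s 8 \<noteq> 0" using Suc.prems(1) by (simp add: loop_inv_def)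
  note exec.While_True[OF this exec_seqs[OF body(1)] s'(1)]
  \<comment> \<open>The 31 instructions, the closing \<open>Skip\<close> of \<open>seqs\<close> and
    the loop test make 33.\<close>
  moreover have "length loop_body + 1 + (33 * x + 1) + 1 = 33 * Suc x + 1"
    by (simp add: loop_body_def)
  ultimately show ?case using s'(2) by metis
qed

text \<open>On lists that are not an \<open>n \<times> n\<close> matrix preceded by \<open>n\<close>, register 4 becomes 0 and nothing is
  done: \<open>n\<close> could be too large for time linear in the length.\<close>

definition guard :: "prog list" where
  "guard = [Load 1 0, Const 2 1, Load 3 2, Binop Mul 4 3 3, Binop Add 4 4 2, Binop Equal 4 4 1]"

text \<open>\<open>\<delta> = 1\<close> appends the vertex 0 to the instance. The memory cell is 0 anyway, so only the length
  changes.\<close>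

definition prepare_loop :: "nat \<Rightarrow> prog list" where
  "prepare_loop \<delta> = [Const 5 4, Const 6 3, Binop Mul 7 3 5, Binop Mul 8 7 7, Binop Add 8 8 8,
     Const 9 (2 + \<delta>), Binop Add 9 9 8]"

text \<open>Runs after the loop because address 2 holds entry (0, 0) of the source matrix until
  then. Vertices and target sets are equally many, so register 7 serves for both.\<close>

definition write_header :: "prog list" where
  "write_header = [Const 10 2, Store 2 7, Store 10 7, Store 0 9]"

definition clear :: "nat list \<Rightarrow> prog list" where
  "clear ks = map (\<lambda>k. Const k 0) ks"

definition transform :: "nat \<Rightarrow> prog" where
  "transform \<delta> = Seq (seqs (prepare_loop \<delta>)) (Seq (While 8 (seqs loop_body)) (seqs write_header))"

definition reduction :: "nat \<Rightarrow> prog" where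
  "reduction \<delta> = Seq (seqs guard) (Seq (Cond 4 (transform \<delta>) Skip) (seqs (clear [1..<19])))"

lemma exec_clear:
  "exec B (seqs (clear ks)) s (length ks + 1) (s\<lparr>reg := \<lambda>k. if k \<in> set ks then 0 else reg s k\<rparr>)"
proof -
  have "fits_all B (clear ks) s"
    by (induction ks arbitrary: s) (auto simp: clear_def)
  moreover have "fold eff (clear ks) s = s\<lparr>reg := \<lambda>k. if k \<in> set ks then 0 else reg s k\<rparr>"
    by (induction ks arbitrary: s)
       (auto simp: clear_def fun_eq_iff cong: if_cong intro!: state.equality)
  ultimately show ?thesis using exec_seqs[of B "clear ks" s] by (simp add: clear_def)
qed

text \<open>The \<open>32 * n\<^sup>2\<close> cells are two square matrices of side
  \<open>4 * n\<close>.\<close>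

definition red_output :: "nat \<Rightarrow> (nat \<Rightarrow> nat) \<Rightarrow> nat \<Rightarrow> nat list" where
  "red_output \<delta> M n = 4 * n # 4 * n # map (cell M n) [0..<32 * n\<^sup>2] @ replicate \<delta> 0"

lemma length_red_output: "length (red_output \<delta> M n) = 32 * n\<^sup>2 + 2 + \<delta>"
  by (simp add: red_output_def)

lemma mem_red_output:
  assumes "\<And>a. a \<ge> 32 * n\<^sup>2 + 3 \<Longrightarrow> M a = 0"
  shows "mem (init (red_output \<delta> M n) w) =
    (\<lambda>a. if 3 \<le> a \<and> a < 32 * n\<^sup>2 + 3 then cell M n (a - 3) else M a)
      (1 := 4 * n, 2 := 4 * n, 0 := 32 * n\<^sup>2 + 2 + \<delta>)"
proof
  fix a
  consider "a = 0" | "a = 1" | "a = 2" | k where "a = Suc (Suc (Suc k))"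
    by (metis One_nat_def Suc_1 not0_implies_Suc)
  then show "mem (init (red_output \<delta> M n) w) a =
    ((\<lambda>a. if 3 \<le> a \<and> a < 32 * n\<^sup>2 + 3 then cell M n (a - 3) else M a)
      (1 := 4 * n, 2 := 4 * n, 0 := 32 * n\<^sup>2 + 2 + \<delta>)) a"
    by cases (auto simp: init_def red_output_def nth_append assms)
qed

lemma exec_transform:
  assumes B: "32 * n\<^sup>2 + 6 \<le> B" and M: "\<And>a. mem s a + 1 \<le> B" and \<delta>: "\<delta> \<le> 1"
    and M0: "\<And>a. a \<ge> 32 * n\<^sup>2 + 3 \<Longrightarrow> mem s a = 0"
    and regs: "reg s 0 = 0" "reg s 2 = 1" "reg s 3 = n" "\<And>k. k \<ge> 19 \<Longrightarrow> reg s k = 0"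
  shows "\<exists>s'. exec B (transform \<delta>) s (8 + (33 * (32 * n\<^sup>2) + 1 + 5)) s' \<and> reg s' 0 = 0 \<and>
    (\<forall>k\<ge>19. reg s' k = 0) \<and> coins s' = coins s \<and> mem s' = mem (init (red_output \<delta> (mem s) n) w)"
proof -
  define s1 where "s1 = fold eff (prepare_loop \<delta>) s"
  have n: "n \<le> n\<^sup>2" by (simp add: power2_eq_square)
  then have "4 * n \<le> B" using B by linarith
  then have "fits_all B (prepare_loop \<delta>) s"
    using B \<delta> regs by (simp add: prepare_loop_def power2_eq_square)
  note e1 = exec_seqs[OF this, folded s1_def]
  have "loop_inv (mem s) n (coins s) (32 * n\<^sup>2 + 2 + \<delta>) (32 * n\<^sup>2) s1"
    using regs by (auto simp: loop_inv_def s1_def prepare_loop_def power2_eq_square)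
  from loop_correct[OF B M this] obtain s2 where
    e2: "exec B (While 8 (seqs loop_body)) s1 (33 * (32 * n\<^sup>2) + 1) s2" and
    inv: "loop_inv (mem s) n (coins s) (32 * n\<^sup>2 + 2 + \<delta>) 0 s2"
    by auto
  define s3 where "s3 = fold eff write_header s2"
  have "fits_all B write_header s2"
    using B by (simp add: write_header_def)
  note e3 = exec_seqs[OF this, folded s3_def]
  have "exec B (transform \<delta>) s (8 + (33 * (32 * n\<^sup>2) + 1 + 5)) s3"
  proof -
    have "length (prepare_loop \<delta>) + 1 = 8" "length write_header + 1 = 5"
      by (simp_all add: prepare_loop_def write_header_def)
    then show ?thesis
      using exec.Seq[OF e1 exec.Seq[OF e2 e3]] by (simp only: transform_def)
  qed
  moreover have "mem s3 = mem (init (red_output \<delta> (mem s) n) w)"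
    using inv by (simp add: loop_inv_def s3_def write_header_def mem_red_output M0)
  ultimately show ?thesis
    using inv by (intro exI[of _ s3]) (simp add: loop_inv_def s3_def write_header_def)
qed

section \<open>Word bounds for the reduction\<close>

lemma word_bound_mono: "c \<le> c' \<Longrightarrow> word_bound c xs \<le> word_bound c' xs"
  unfolding word_bound_def by (rule power_increasing) auto

text \<open>The base of the power is at least \<open>n + 2\<close>. Five factors give 32 and two
  give \<open>n\<^sup>2 + 4\<close>, whence the exponent 7 and the constant 128.\<close>

lemma le_word_bound:
  assumes "n \<in> insert (length xs) (set xs)"
  shows "32 * n\<^sup>2 + 128 \<le> word_bound 7 xs"
proof -
  define z where "z = Max (insert (length xs) (set xs)) + 2"
  have z: "n + 2 \<le> z"
    using assms Max_ge[of "insert (length xs) (set xs)" n] by (simp add: z_def)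
  then have "2 ^ 5 \<le> z ^ 5" by (intro power_mono) auto
  moreover have "n\<^sup>2 + 4 \<le> z\<^sup>2"
    using power_mono[OF z, of 2] by (simp add: power2_eq_square algebra_simps)
  ultimately have "2 ^ 5 * (n\<^sup>2 + 4) \<le> z ^ 5 * z\<^sup>2" by (rule mult_le_mono)
  also have "\<dots> = z ^ 7" by (simp flip: power_add)
  finally show ?thesis by (simp add: word_bound_def z_def)
qed

lemma mem_init_le_word_bound: "mem (init xs w) a + 1 \<le> word_bound 7 xs"
proof -
  have *: "k + 1 \<le> word_bound 7 xs" if "k \<in> insert (length xs) (set xs)" for k
  proof -
    have "k \<le> k\<^sup>2" by (simp add: power2_eq_square)
    then show ?thesis using le_word_bound[OF that] by linarith
  qed
  show ?thesis
  proof (cases "a \<le> length xs")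
    case True
    then have "(length xs # xs) ! a \<in> set (length xs # xs)" by (intro nth_mem) simp
    then show ?thesis using *[of "(length xs # xs) ! a"] True by (simp add: init_def)
  next
    case False
    then show ?thesis using *[of "length xs"] by (simp add: init_def)
  qed
qed

text \<open>A linear preprocessing must behave well on every list, so inputs that fail the guard are
  covered too; the proof returns them unchanged.\<close>

lemma exec_reduction:
  fixes xs :: "nat list" and w :: "bool stream" and \<delta> :: nat
  defines "n \<equiv> mem (init xs w) 1"
  assumes \<delta>: "\<delta> \<le> 1"
  shows "\<exists>t ys. exec (word_bound 7 xs) (reduction \<delta>) (init xs w) t (init ys w) \<and>
    t \<le> 2000 * (length xs + 1) \<and> length ys \<le> 2000 * (length xs + 1) \<and>
    (n * n + 1 = length xs \<longrightarrow> ys = red_output \<delta> (mem (init xs w)) n)"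
proof -
  let ?B = "word_bound 7 xs" and ?s = "init xs w"
  define s1 where "s1 = fold eff guard ?s"
  \<comment> \<open>The alternative \<open>n = 0\<close> is for the empty list, where address 1 is
    blank.\<close>
  have n_mem: "n \<in> insert (length xs) (set xs) \<or> n = 0"
    by (auto simp: n_def init_def Suc_le_eq)
  then have B: "32 * n\<^sup>2 + 128 \<le> ?B"
    using le_word_bound[of n xs] le_word_bound[of "length xs" xs] by auto
  have "fits_all ?B guard ?s"
    using B by (auto simp: guard_def n_def init_def power2_eq_square)
  note e1 = exec_seqs[OF this, folded s1_def]
  have s1: "mem s1 = mem ?s" "coins s1 = w" "reg s1 0 = 0" "reg s1 2 = 1" "reg s1 3 = n"
    "reg s1 4 = of_bool (n * n + 1 = length xs)" "\<And>k. k \<ge> 19 \<Longrightarrow> reg s1 k = 0"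
    by (auto simp: s1_def guard_def n_def init_def)
  \<comment> \<open>Here 1056 is 33 steps for each of 32 cells per matrix entry.\<close>
  have "\<exists>t s2 ys. exec ?B (Cond 4 (transform \<delta>) Skip) s1 t s2 \<and> reg s2 0 = 0 \<and>
      (\<forall>k\<ge>19. reg s2 k = 0) \<and> coins s2 = w \<and> mem s2 = mem (init ys w) \<and>
      t \<le> 1056 * length xs + 15 \<and> length ys \<le> 32 * length xs + 3 \<and>
      (n * n + 1 = length xs \<longrightarrow> ys = red_output \<delta> (mem ?s) n)"
  proof (cases "n * n + 1 = length xs")
    case True
    have "mem s1 a = 0" if "a \<ge> 32 * n\<^sup>2 + 3" for a
      using that True unfolding s1 by (auto simp: init_def power2_eq_square)
    from exec_transform[OF _ _ \<delta> this s1(3-5,7), of ?B w] obtain s2 where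
      s2: "exec ?B (transform \<delta>) s1 (8 + (33 * (32 * n\<^sup>2) + 1 + 5)) s2" "reg s2 0 = 0"
      "\<forall>k\<ge>19. reg s2 k = 0" "coins s2 = coins s1" "mem s2 = mem (init (red_output \<delta> (mem s1) n) w)"
      using B mem_init_le_word_bound s1(1) by auto
    have "reg s1 4 \<noteq> 0" using s1 True by simp
    from exec.Cond_True[OF this s2(1), of Skip] s2 True show ?thesis
      unfolding s1 using \<delta>
      by (intro exI[of _ "8 + (33 * (32 * n\<^sup>2) + 1 + 5) + 1"] exI[of _ s2]
          exI[of _ "red_output \<delta> (mem ?s) n"])
        (auto simp: length_red_output power2_eq_square s1)
  next
    case False
    then have "reg s1 4 = 0" using s1 by simp
    from exec.Cond_False[OF this exec.Skip[of ?B], of "transform \<delta>"] s1 False show ?thesis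
      by (intro exI[of _ 2] exI[of _ s1] exI[of _ xs]) (auto simp: numeral_2_eq_2)
  qed
  then obtain t s2 ys where
    s2: "exec ?B (Cond 4 (transform \<delta>) Skip) s1 t s2" "reg s2 0 = 0"
      "\<forall>k\<ge>19. reg s2 k = 0" "coins s2 = w" "mem s2 = mem (init ys w)"
      "t \<le> 1056 * length xs + 15" "length ys \<le> 32 * length xs + 3"
      "n * n + 1 = length xs \<longrightarrow> ys = red_output \<delta> (mem ?s) n"
    by blast
  \<comment> \<open>Register 0 and those from 19 on still hold 0, so clearing 1 to 18 restores the
    initial registers.\<close>
  have "reg (init ys w) = (\<lambda>k. if k \<in> set [1..<19] then 0 else reg s2 k)"
  proof
    fix k :: nat
    consider "k = 0" | "1 \<le> k \<and> k < 19" | "k \<ge> 19" by linarith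
    then show "reg (init ys w) k = (if k \<in> set [1..<19] then 0 else reg s2 k)"
      by cases (use s2 in \<open>auto simp: init_def\<close>)
  qed
  then have "s2\<lparr>reg := \<lambda>k. if k \<in> set [1..<19] then 0 else reg s2 k\<rparr> = init ys w"
    using s2 by (simp add: init_def)
  with exec_clear[of ?B "[1..<19]" s2]
  have e3: "exec ?B (seqs (clear [1..<19])) s2 19 (init ys w)" by simp
  from exec.Seq[OF e1 exec.Seq[OF s2(1) e3]]
  have "exec ?B (reduction \<delta>) ?s (length guard + 1 + (t + 19)) (init ys w)"
    by (simp only: reduction_def)
  moreover have "length guard = 6" by (simp add: guard_def)
  ultimately show ?thesis
    using s2 by (intro exI conjI) auto
qed

lemma linear_preprocessing_reduction:
  assumes "\<delta> \<le> 1"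
  shows "linear_preprocessing (reduction \<delta>)"
proof -
  \<comment> \<open>A single constant has to serve both as word exponent and as linear
    factor.\<close>
  have "word_bound 7 xs \<le> word_bound 2000 xs" for xs by (rule word_bound_mono) simp
  then show ?thesis
    unfolding linear_preprocessing_def
    using exec_reduction[OF assms] exec_mono by (intro exI[of _ 2000]) blast
qed

section \<open>The safety instance of a graph\<close>

text \<open>The term \<open>u mod 4 mod 3 + 1\<close> is the next layer: 0, 1, 2, 3 go to 1, 2, 3,
  1.\<close>

definition red_edges :: "nat \<Rightarrow> nat set set \<Rightarrow> (nat \<times> nat) set" where
  "red_edges n E = {(u, v). u < 4 * n \<and> v < 4 * n \<and> v mod 4 = u mod 4 mod 3 + 1 \<and>
     (u mod 4 = 0 \<or> {u div 4, v div 4} \<in> E)}"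

text \<open>Each set is listed four times to have as many target sets as vertices, the case that
  \<open>D\<close> is known to admit.\<close>

definition red_targets :: "nat \<Rightarrow> nat set list" where
  "red_targets n = map (\<lambda>i. {v. v < 4 * n \<and> v mod 4 = 1 \<and> v div 4 \<noteq> i div 4}) [0..<4 * n]"

section \<open>Safe plays and triangles\<close>

lemma winning_objective_eq_query: "disj_objective_winning V E Ts = disj_query_winning V E Ts"
  by (auto simp: disj_objective_winning_def disj_query_winning_def winning_set_def)

lemma mem_disj_query_winning:
  "v \<in> disj_query_winning V E Ts \<longleftrightarrow>
    v \<in> V \<and> (\<exists>T\<in>set Ts. \<exists>\<pi>\<in>plays V E. (\<forall>i. \<pi> i \<notin> T) \<and> \<pi> 0 = v)"
  by (auto simp: disj_query_winning_def winning_set_def safety_def)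

lemma triangle_if_winning:
  assumes "v \<in> disj_query_winning {..<4 * n} (red_edges n E) (red_targets n)"
  shows "has_triangle E"
proof -
  from assms obtain T \<pi> where T: "T \<in> set (red_targets n)" "\<And>k. \<pi> k \<notin> T"
    and \<pi>: "\<pi> \<in> plays {..<4 * n} (red_edges n E)"
    unfolding mem_disj_query_winning by blast
  from T(1) obtain i where "T = {v. v < 4 * n \<and> v mod 4 = 1 \<and> v div 4 \<noteq> i div 4}"
    unfolding red_targets_def by auto
  moreover have "\<pi> k < 4 * n" for k using \<pi> by (auto simp: plays_def)
  ultimately have safe: "\<pi> k div 4 = i div 4" if "\<pi> k mod 4 = 1" for k
    using T(2)[of k] that by simp
  have \<pi>': "(\<pi> k, \<pi> (Suc k)) \<in> red_edges n E" for k using \<pi> by (simp add: plays_def)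
  have step: "\<pi> (Suc k) mod 4 = \<pi> k mod 4 mod 3 + 1"
    and edge: "\<pi> k mod 4 \<noteq> 0 \<Longrightarrow> {\<pi> k div 4, \<pi> (Suc k) div 4} \<in> E" for k
    using \<pi>'[of k] by (auto simp: red_edges_def)
  \<comment> \<open>From any layer, layer 1 is reached within two steps.\<close>
  have "\<exists>m. \<pi> m mod 4 = 1"
  proof -
    consider "\<pi> 0 mod 4 = 0" | "\<pi> 0 mod 4 = 1" | "\<pi> 0 mod 4 = 2" | "\<pi> 0 mod 4 = 3" by linarith
    then show ?thesis
    proof cases
      case 3
      then have "\<pi> 2 mod 4 = 1" using step[of 0] step[of 1] by (simp add: numeral_2_eq_2)
      then show ?thesis by blast
    qed (use step[of 0] in \<open>auto intro: exI[of _ 1]\<close>)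
  qed
  then obtain m where m0: "\<pi> m mod 4 = 1" by blast
  have m1: "\<pi> (Suc m) mod 4 = 2" using step[of m] m0 by simp
  have m2: "\<pi> (Suc (Suc m)) mod 4 = 3" using step[of "Suc m"] m1 by simp
  have m3: "\<pi> (Suc (Suc (Suc m))) mod 4 = 1" using step[of "Suc (Suc m)"] m2 by simp
  define x y z where "x = i div 4" and "y = \<pi> (Suc m) div 4" and "z = \<pi> (Suc (Suc m)) div 4"
  have "{x, y} \<in> E" using edge[of m] m0 safe[OF m0] by (simp add: x_def y_def)
  moreover have "{y, z} \<in> E" using edge[of "Suc m"] m1 by (simp add: y_def z_def)
  \<comment> \<open>Positions \<open>m\<close> and \<open>m + 3\<close> both lie in layer 1, where
    safety fixes the copy, so the walk closes at \<open>x\<close>.\<close>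
  moreover have "{z, x} \<in> E"
    using edge[of "Suc (Suc m)"] m2 safe[OF m3] by (simp add: x_def z_def)
  then have "{x, z} \<in> E" by (simp add: insert_commute)
  ultimately show ?thesis unfolding has_triangle_def by blast
qed

lemma winning_if_triangle:
  assumes "has_triangle E" "simple_graph n E"
  shows "0 \<in> disj_query_winning {..<4 * n} (red_edges n E) (red_targets n)"
proof -
  from assms(1) obtain a b c where E: "{a, b} \<in> E" "{b, c} \<in> E" "{a, c} \<in> E"
    unfolding has_triangle_def by blast
  then have less: "a < n" "b < n" "c < n"
    using assms(2) by (auto simp: simple_graph_def)
  \<comment> \<open>The play leaves the source 0 and circles forever through the copies of
    \<open>a\<close>, \<open>b\<close>, \<open>c\<close> in layers 1, 2, 3.\<close>
  define \<pi> where "\<pi> k = (if k = 0 then 0 else if k mod 3 = 1 then 4 * a + 1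
    else if k mod 3 = 2 then 4 * b + 2 else 4 * c + 3)" for k :: nat
  have *: "{c, a} \<in> E" using E by (simp add: insert_commute)
  have "(\<pi> k, \<pi> (Suc k)) \<in> red_edges n E" for k
  proof -
    have [simp]: "Suc (4 * i) div 4 = i" "Suc (Suc (4 * i)) div 4 = i" for i by presburger+
    consider "k = 0" | "k \<noteq> 0" "k mod 3 = 0" | "k mod 3 = 1" | "k mod 3 = 2" by linarith
    then show ?thesis
      by cases (use E * less in \<open>auto simp: \<pi>_def red_edges_def mod_Suc\<close>)
  qed
  moreover have "\<pi> k < 4 * n" for k using less by (auto simp: \<pi>_def)
  ultimately have play: "\<pi> \<in> plays {..<4 * n} (red_edges n E)" by (auto simp: plays_def)
  have T: "red_targets n ! (4 * a) \<in> set (red_targets n)"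
    using less by (intro nth_mem) (simp add: red_targets_def)
  have "\<pi> k mod 4 = 1 \<longrightarrow> \<pi> k div 4 = a" for k
    by (auto simp: \<pi>_def) presburger+
  then have "\<forall>k. \<pi> k \<notin> red_targets n ! (4 * a)"
    using less by (simp add: red_targets_def)
  with play T show ?thesis
    unfolding mem_disj_query_winning
    using less by (intro conjI bexI[of _ \<pi>] bexI[OF _ T]) (auto simp: \<pi>_def)
qed

section \<open>Agreement of the program output with the encoded instance\<close>

lemma matrix_entries_eq_map:
  "matrix_entries r c M = map (\<lambda>k. M (k div c) (k mod c)) [0..<r * c]"
proof (induction r)
  case 0
  then show ?case by (simp add: matrix_entries_def)
next
  case (Suc r)
  have "[0..<Suc r * c] = [0..<r * c] @ map (\<lambda>k. k + r * c) [0..<c]"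
    using upt_add_eq_append[of 0 "r * c" c] by (simp add: add.commute map_add_upt)
  moreover have "matrix_entries (Suc r) c M = matrix_entries r c M @ map (M r) [0..<c]"
    by (simp add: matrix_entries_def)
  ultimately show ?case using Suc by auto
qed

text \<open>The offset 2 skips the length at address 0 and \<open>n\<close> at address 1.\<close>

lemma mem_enc_matrix_graph:
  assumes "i < n" "j < n"
  shows "mem (init (enc_matrix_graph (n, E)) w) (i * n + j + 2) = of_bool ({i, j} \<in> E)"
proof -
  have "i * n + j < Suc i * n" using assms by simp
  also have "\<dots> \<le> n * n" using assms by (intro mult_le_mono) auto
  finally show ?thesis using assms by (simp add: init_def matrix_entries_eq_map)
qed

lemma red_output_enc_matrix_graph:
  "red_output \<delta> (mem (init (enc_matrix_graph (n, E)) w)) n =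
    enc_safety (4 * n, red_edges n E, red_targets n) @ replicate \<delta> 0"
proof -
  let ?M = "mem (init (enc_matrix_graph (n, E)) w)" and ?N = "4 * n"
  have split: "[0..<32 * n\<^sup>2] = [0..<?N * ?N] @ map (\<lambda>k. k + ?N * ?N) [0..<?N * ?N]"
    using upt_add_eq_append[of 0 "?N * ?N" "?N * ?N"] by (simp add: map_add_upt power2_eq_square)
  have "cell ?M n x = of_bool ((x div ?N, x mod ?N) \<in> red_edges n E)
      \<and> cell ?M n (x + ?N * ?N) = of_bool (x mod ?N \<in> red_targets n ! (x div ?N))"
    if "x < ?N * ?N" for x
  proof -
    define r c where "r = x div ?N" and "c = x mod ?N"
    have n: "n > 0" using that by (cases n) auto
    have rc: "r < ?N" "c < ?N"
      using that n by (auto simp: r_def c_def less_mult_imp_div_less)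
    \<comment> \<open>Moving from an edge row to the target row of the same index adds
      \<open>n\<close> to the quotient by 4, which vanishes modulo \<open>n\<close>.\<close>
    have [simp]: "(r + ?N) div 4 mod n = r div 4" "r div 4 mod n = r div 4"
      using rc by auto
    have "cell ?M n x = of_bool ((r, c) \<in> red_edges n E)"
      using rc mem_enc_matrix_graph[of "r div 4" n "c div 4" E w]
      by (auto simp: cell_def Let_def red_edges_def simp flip: r_def c_def)
    moreover have "(x + ?N * ?N) div ?N = r + ?N" "(x + ?N * ?N) mod ?N = c"
      unfolding r_def c_def using n by (simp_all only: div_mult_self1 mod_mult_self1)
    then have "cell ?M n (x + ?N * ?N) = of_bool (c \<in> red_targets n ! r)"
      using rc by (auto simp: cell_def Let_def red_targets_def)
    ultimately show ?thesis by (simp add: r_def c_def)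
  qed
  then show ?thesis
    unfolding red_output_def split
    by (simp add: matrix_entries_eq_map red_targets_def)
qed

section \<open>Transfer of running times\<close>

text \<open>One transfer for all three problem variants: \<open>h\<close> embeds graphs as
  instances, and \<open>ok\<close> only has to reveal the answer in cell 0. The quadratic cost of
  the reduction is absorbed because \<open>\<epsilon> \<le> 1\<close>.\<close>

lemma solves_triangle_if_solves_safety:
  assumes solves: "solves_in_time I enc ok g p"
    and \<delta>: "\<delta> \<le> 1" and \<epsilon>: "\<epsilon> \<le> 1"
    and I: "\<And>n E. (n, E) \<in> matrix_graphs \<Longrightarrow> h n E \<in> I"
    and enc: "\<And>n E. enc (h n E) =
      enc_safety (4 * n, red_edges n E, red_targets n) @ replicate \<delta> 0"
    and ok: "\<And>n E M. (n, E) \<in> matrix_graphs \<Longrightarrow> ok (h n E) M \<Longrightarrow> M 0 \<noteq> 0 \<longleftrightarrow> has_triangle E"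
    and g: "\<And>n E. n \<ge> 1 \<Longrightarrow> g (h n E) \<le> (4 * real n) powr (3 - \<epsilon>)"
    and g0: "\<And>n E. 0 \<le> g (h n E)"
  shows "solves_in_time matrix_graphs enc_matrix_graph (decides (\<lambda>(n, E). has_triangle E))
    (\<lambda>(n, E). real n powr (3 - \<epsilon>)) (Seq (reduction \<delta>) p)"
proof -
  from solves obtain K c where
    p: "\<And>x w. x \<in> I \<Longrightarrow> \<exists>t s. exec (word_bound c (enc x)) p (init (enc x) w) t s \<and>
      ok x (mem s) \<and> real t \<le> K * g x"
    unfolding solves_in_time_def by blast
  \<comment> \<open>The bound \<open>2000 * (n * n + 2)\<close> is at most
    \<open>6000 * (n * n)\<close>; the absolute value is taken since \<open>K\<close> may be
    negative.\<close>
  define C where "C = 6000 + \<bar>K\<bar> * 4 powr (3 - \<epsilon>)"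
  have "\<exists>t s. exec (word_bound (7 * (c + 1)) (enc_matrix_graph (n, E))) (Seq (reduction \<delta>) p)
      (init (enc_matrix_graph (n, E)) w) t s \<and>
      (mem s 0 \<noteq> 0 \<longleftrightarrow> has_triangle E) \<and> real t \<le> C * real n powr (3 - \<epsilon>)"
    if x: "(n, E) \<in> matrix_graphs" for n E w
  proof -
    let ?xs = "enc_matrix_graph (n, E)" and ?ys = "enc (h n E)"
    have n: "n \<ge> 1" using x by (simp add: matrix_graphs_def)
    have len: "length ?xs = n * n + 1" by (simp add: matrix_entries_eq_map)
    have first: "mem (init ?xs w) 1 = n" by (simp add: init_def)
    have ys: "?ys = red_output \<delta> (mem (init ?xs w)) n"
      by (simp only: enc red_output_enc_matrix_graph)
    from exec_reduction[OF \<delta>, where xs = ?xs and w = w] obtain t1 where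
      t1: "exec (word_bound 7 ?xs) (reduction \<delta>) (init ?xs w) t1 (init ?ys w)"
        "t1 \<le> 2000 * (n * n + 2)"
      unfolding first len ys by auto
    from p[OF I[OF x], of w] obtain t2 s where
      t2: "exec (word_bound c ?ys) p (init ?ys w) t2 s" "ok (h n E) (mem s)"
        "real t2 \<le> K * g (h n E)"
      by blast
    \<comment> \<open>Length and entries of the output are at most quadratic in \<open>n\<close>, so
      exponent \<open>c\<close> on the output is covered by exponent \<open>7 * c\<close> on the
      input.\<close>
    have "k \<le> 32 * n\<^sup>2 + 3" if "k \<in> insert (length ?ys) (set ?ys)" for k
    proof -
      have "n \<le> n\<^sup>2" by (simp add: power2_eq_square)
      moreover have "cell M n k \<le> 1" for M k by (simp add: cell_def Let_def)
      then have "cell M n k \<le> 32 * n\<^sup>2 + 3" for M k by (rule le_trans) simp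
      ultimately show ?thesis
        using that \<delta> unfolding ys by (auto simp: red_output_def)
    qed
    then have "Max (insert (length ?ys) (set ?ys)) \<le> 32 * n\<^sup>2 + 3"
      by (intro Max.boundedI) blast+
    then have "Max (insert (length ?ys) (set ?ys)) + 2 \<le> 32 * n\<^sup>2 + 128" by linarith
    also have "\<dots> \<le> word_bound 7 ?xs" by (rule le_word_bound) simp
    finally have "word_bound c ?ys \<le> word_bound 7 ?xs ^ c"
      unfolding word_bound_def[of c] by (rule power_mono) simp
    also have "\<dots> = word_bound (7 * c) ?xs"
      by (simp only: word_bound_def power_mult)
    also have "\<dots> \<le> word_bound (7 * (c + 1)) ?xs" by (rule word_bound_mono) simp
    finally have "exec (word_bound (7 * (c + 1)) ?xs) p (init ?ys w) t2 s"
      using t2(1) exec_mono by blast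
    moreover have "exec (word_bound (7 * (c + 1)) ?xs) (reduction \<delta>) (init ?xs w) t1 (init ?ys w)"
      using t1(1) by (rule exec_mono) (auto intro: word_bound_mono)
    ultimately have "exec (word_bound (7 * (c + 1)) ?xs) (Seq (reduction \<delta>) p) (init ?xs w)
        (t1 + t2) s"
      by (intro exec.Seq)
    moreover have "mem s 0 \<noteq> 0 \<longleftrightarrow> has_triangle E" using ok[OF x t2(2)] .
    moreover have "real (t1 + t2) \<le> C * real n powr (3 - \<epsilon>)"
    proof -
      have "1 \<le> n * n" using n by simp
      with t1(2) have "t1 \<le> 6000 * (n * n)" unfolding distrib_left by linarith
      then have "real t1 \<le> real (6000 * (n * n))" by (simp only: of_nat_le_iff)
      also have "\<dots> = 6000 * real n powr 2" using n by (simp add: power2_eq_square)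
      also have "\<dots> \<le> 6000 * real n powr (3 - \<epsilon>)"
        using n \<epsilon> by (intro mult_left_mono powr_mono) auto
      finally have A: "real t1 \<le> 6000 * real n powr (3 - \<epsilon>)" .
      have "K * g (h n E) \<le> \<bar>K\<bar> * (4 * real n) powr (3 - \<epsilon>)"
        using g[OF n, of E] g0[of n E] by (intro mult_mono) auto
      then have "real t2 \<le> \<bar>K\<bar> * (4 powr (3 - \<epsilon>) * real n powr (3 - \<epsilon>))"
        using t2(3) by (simp add: powr_mult)
      with A show ?thesis by (simp add: C_def algebra_simps)
    qed
    ultimately show ?thesis by blast
  qed
  then show ?thesis
    unfolding solves_in_time_def decides_def
    by (intro exI[of _ C] exI[of _ "7 * (c + 1)"]) (auto simp del: enc_matrix_graph.simps)
qed

theorem theorem4: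
  fixes combinatorial :: "prog \<Rightarrow> bool"
    and D :: "nat \<Rightarrow> nat \<Rightarrow> bool"
  assumes "closed_under_linear_preprocessing combinatorial"
    and "strong_triangle_conjecture combinatorial"
    and "\<And>n. n \<ge> 1 \<Longrightarrow> D n n"
  shows "\<forall>\<epsilon>>0. \<forall>W \<in> {disj_objective_winning, disj_query_winning}.
    \<forall>f \<in> {\<lambda>n k. real n powr (3 - \<epsilon>), \<lambda>n k. (real k * real n ^ 2) powr (1 - \<epsilon>)}.
      \<not> (\<exists>p. combinatorial p \<and> computes_winning_set D W f p) \<and>
      \<not> (\<exists>p. combinatorial p \<and> decides_winning_nonempty D W f p) \<and>
      \<not> (\<exists>p. combinatorial p \<and> decides_winning_vertex D W f p)"
proof (intro allI impI ballI)
  fix \<epsilon> :: real and W :: winning and f :: "nat \<Rightarrow> nat \<Rightarrow> real"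
  assume \<epsilon>: "\<epsilon> > 0" and W: "W \<in> {disj_objective_winning, disj_query_winning}"
    and f: "f \<in> {\<lambda>n k. real n powr (3 - \<epsilon>), \<lambda>n k. (real k * real n ^ 2) powr (1 - \<epsilon>)}"
  \<comment> \<open>Capping at 1 keeps the target bound at least quadratic, leaving time for the
    reduction itself.\<close>
  define \<epsilon>' where "\<epsilon>' = min \<epsilon> 1"
  have \<epsilon>': "0 < \<epsilon>'" "\<epsilon>' \<le> 1" "\<epsilon>' \<le> \<epsilon>" using \<epsilon> by (auto simp: \<epsilon>'_def)
  define inst where "inst n E = (4 * n, red_edges n E, red_targets n)" for n E
  have k: "length (red_targets n) = 4 * n" for n by (simp add: red_targets_def)
  have inst: "inst n E \<in> safety_instances D" if "(n, E) \<in> matrix_graphs" for n E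
    using that assms(3)[of "4 * n"]
    by (auto simp: safety_instances_def inst_def matrix_graphs_def k red_edges_def red_targets_def)
  have WQ: "W = disj_query_winning"
    using W by (auto simp: fun_eq_iff winning_objective_eq_query)
  have zero: "0 \<in> W {..<4 * n} (red_edges n E) (red_targets n) \<longleftrightarrow> has_triangle E"
    and nonempty: "W {..<4 * n} (red_edges n E) (red_targets n) \<noteq> {} \<longleftrightarrow> has_triangle E"
    if "(n, E) \<in> matrix_graphs" for n E
    using that triangle_if_winning winning_if_triangle unfolding WQ matrix_graphs_def by blast+
  have f_le: "f (4 * n) (4 * n) \<le> (4 * real n) powr (3 - \<epsilon>')" if "n \<ge> 1" for n
  proof -
    have "f (4 * n) (4 * n) \<le> (4 * real n) powr (3 - \<epsilon>)"
    proof -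
      \<comment> \<open>With as many target sets as vertices, the second bound has exponent
        \<open>3 - 3 * \<epsilon>\<close>.\<close>
      have "(real (4 * n) * real (4 * n) ^ 2) powr (1 - \<epsilon>) = ((4 * real n) powr 3) powr (1 - \<epsilon>)"
        using that by (simp add: power3_eq_cube power2_eq_square)
      also have "\<dots> = (4 * real n) powr (3 * (1 - \<epsilon>))" by (rule powr_powr)
      also have "\<dots> \<le> (4 * real n) powr (3 - \<epsilon>)"
        using that \<epsilon> by (intro powr_mono) auto
      finally show ?thesis using f by auto
    qed
    also have "\<dots> \<le> (4 * real n) powr (3 - \<epsilon>')"
      using that \<epsilon>' by (intro powr_mono) auto
    finally show ?thesis .
  qed
  have f0: "0 \<le> f a b" for a b using f by auto
  have no: False
    if "combinatorial p" "\<delta> \<le> 1" "solves_in_time matrix_graphs enc_matrix_graph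
      (decides (\<lambda>(n, E). has_triangle E)) (\<lambda>(n, E). real n powr (3 - \<epsilon>')) (Seq (reduction \<delta>) p)"
    for p \<delta>
  proof -
    have "combinatorial (Seq (reduction \<delta>) p)"
      using assms(1) that linear_preprocessing_reduction
      unfolding closed_under_linear_preprocessing_def by blast
    then show False
      using assms(2) that(3) \<epsilon>'(1) unfolding strong_triangle_conjecture_def by blast
  qed
  \<comment> \<open>Cell 0 of the characteristic vector belongs to vertex 0, which wins iff there is
    a triangle.\<close>
  have "False" if "combinatorial p" "computes_winning_set D W f p" for p
    using that(1) zero_le_one
  proof (rule no)
    show "solves_in_time matrix_graphs enc_matrix_graph (decides (\<lambda>(n, E). has_triangle E))
      (\<lambda>(n, E). real n powr (3 - \<epsilon>')) (Seq (reduction 0) p)"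
      by (rule solves_triangle_if_solves_safety[where h = inst,
            OF that(2)[unfolded computes_winning_set_def] _ \<epsilon>'(2)])
         (use inst zero f_le f0 in \<open>auto simp: inst_def k matrix_graphs_def\<close>)
  qed
  moreover have "False" if "combinatorial p" "decides_winning_nonempty D W f p" for p
    using that(1) zero_le_one
  proof (rule no)
    show "solves_in_time matrix_graphs enc_matrix_graph (decides (\<lambda>(n, E). has_triangle E))
      (\<lambda>(n, E). real n powr (3 - \<epsilon>')) (Seq (reduction 0) p)"
      by (rule solves_triangle_if_solves_safety[where h = inst,
            OF that(2)[unfolded decides_winning_nonempty_def] _ \<epsilon>'(2)])
         (use inst nonempty f_le f0 in \<open>auto simp: inst_def k decides_def\<close>)
  qed
  \<comment> \<open>Here the query vertex 0 must be appended to the input, hence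
    \<open>reduction 1\<close>.\<close>
  moreover have "False" if "combinatorial p" "decides_winning_vertex D W f p" for p
    using that(1) order_refl
  proof (rule no)
    show "solves_in_time matrix_graphs enc_matrix_graph (decides (\<lambda>(n, E). has_triangle E))
      (\<lambda>(n, E). real n powr (3 - \<epsilon>')) (Seq (reduction 1) p)"
      by (rule solves_triangle_if_solves_safety[where h = "\<lambda>n E. (inst n E, 0)",
            OF that(2)[unfolded decides_winning_vertex_def] _ \<epsilon>'(2)])
         (use inst zero f_le f0 in
           \<open>auto simp: inst_def k decides_def vertex_instances_def matrix_graphs_def\<close>)
  qed
  ultimately show "\<not> (\<exists>p. combinatorial p \<and> computes_winning_set D W f p) \<and>
      \<not> (\<exists>p. combinatorial p \<and> decides_winning_nonempty D W f p) \<and>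
      \<not> (\<exists>p. combinatorial p \<and> decides_winning_vertex D W f p)"
    by blast
qed

end
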